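(* Let $\alpha\in(0,2]$ and $\alpha'\in(0,1]$. Then $$L_{\alpha\alpha'}\stackrel{d}{=}S_{\alpha,0}\,M_{\alpha'}^{1/\alpha},$$ where the random variables $S_{\alpha,0}$ and $M_{\alpha'}$ on the right-hand side are independent.
   Context: $\stackrel{d}{=}$ denotes equality in distribution. For $\beta\in(0,2]$, $L_\beta$ denotes a random variable with the Linnik distribution with parameter $\beta$, i.e. with characteristic function $1/(1+|t|^{\beta})$, $t\in\mathbb{R}$. For $\alpha\in(0,2]$, $S_{\alpha,0}$ denotes a random variable with the symmetric strictly stable distribution with characteristic function $e^{-|t|^{\alpha}}$, $t\in\mathbb{R}$. For $\delta\in(0,1]$, $M_\delta$ denotes a nonnegative random variable with the (standard) Mittag-Leffler distribution, i.e. with Laplace transform $\mathsf{E}e^{-sM_\delta}=1/(1+s^{\delta})$, $s\ge 0$. *)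

theory Defs
  imports "HOL-Probability.Probability"
begin

text \<open>
  The predicates below refer to a random variable \<open>X\<close> on a probability space \<open>P\<close>; that \<open>P\<close> is a
  probability space and the range of the parameter are to be assumed where they are used. For a
  positive exponent the terms at \<open>t = 0\<close> and \<open>s = 0\<close> are as usual, since \<open>0 powr \<beta> = 0\<close>.
\<close>

definition linnik_rv :: "'a measure \<Rightarrow> real \<Rightarrow> ('a \<Rightarrow> real) \<Rightarrow> bool" where
  "linnik_rv P \<beta> X \<longleftrightarrow>
     X \<in> borel_measurable P \<and>
     (\<forall>t. char (distr P borel X) t = complex_of_real (1 / (1 + \<bar>t\<bar> powr \<beta>)))"

definition symmetric_stable_rv :: "'a measure \<Rightarrow> real \<Rightarrow> ('a \<Rightarrow> real) \<Rightarrow> bool" where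
  "symmetric_stable_rv P \<alpha> X \<longleftrightarrow>
     X \<in> borel_measurable P \<and>
     (\<forall>t. char (distr P borel X) t = complex_of_real (exp (- (\<bar>t\<bar> powr \<alpha>))))"

text \<open>
  Nonnegativity is only required almost surely. The integrand below is then almost surely bounded
  by 1, so for a probability space the Bochner integral is a genuine expectation.
\<close>

definition mittag_leffler_rv :: "'a measure \<Rightarrow> real \<Rightarrow> ('a \<Rightarrow> real) \<Rightarrow> bool" where
  "mittag_leffler_rv P \<delta> X \<longleftrightarrow>
     X \<in> borel_measurable P \<and>
     (AE \<omega> in P. 0 \<le> X \<omega>) \<and>
     (\<forall>s\<ge>0. (LINT \<omega>|P. exp (- (s * X \<omega>))) = 1 / (1 + s powr \<delta>))"

end

theory Submission
  imports Defs
begin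

text \<open>
  A probability measure on the line is determined by its characteristic function, so it suffices
  to compute that of \<open>S M\<^sup>1\<^sup>/\<^sup>\<alpha>\<close>. Conditionally on \<open>M\<close>, the product is the stable variable \<open>S\<close>
  scaled by \<open>M\<^sup>1\<^sup>/\<^sup>\<alpha>\<close>, and the exponent \<open>1 / \<alpha>\<close> is exactly what makes the conditional
  characteristic function an exponential that is linear in \<open>M\<close>:
  \<open>exp (- \<bar>t M\<^sup>1\<^sup>/\<^sup>\<alpha>\<bar>\<^sup>\<alpha>) = exp (- \<bar>t\<bar>\<^sup>\<alpha> M)\<close>. Averaging over \<open>M\<close> therefore evaluates the
  Laplace transform of the Mittag-Leffler law at \<open>\<bar>t\<bar> powr \<alpha>\<close>, which gives
  \<open>1 / (1 + (\<bar>t\<bar> powr \<alpha>) powr \<alpha>')\<close>: the Linnik characteristic function with parameter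
  \<open>\<alpha> * \<alpha>'\<close>. Averaging over the second factor is justified by \<open>char_indep_mult\<close>; the pointwise
  scaling identity is \<open>stable_exponent_scale\<close>.
\<close>

text \<open>
  Under independence the joint law is the product of the marginals, so the expectation of
  \<open>exp (i t X Y)\<close> can be taken first over \<open>X\<close> with \<open>Y\<close> held fixed; Fubini applies because the
  integrand has modulus one.
\<close>

lemma (in prob_space) char_indep_mult:
  fixes X Y :: "'a \<Rightarrow> real"
  assumes "indep_var borel X borel Y"
  shows "char (distr M borel (\<lambda>\<omega>. X \<omega> * Y \<omega>)) t
    = (LINT \<omega>|M. char (distr M borel X) (t * Y \<omega>))"
proof -
  have [measurable]: "X \<in> borel_measurable M" "Y \<in> borel_measurable M"
    and joint: "distr M borel X \<Otimes>\<^sub>M distr M borel Y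
      = distr M (borel \<Otimes>\<^sub>M borel) (\<lambda>\<omega>. (X \<omega>, Y \<omega>))"
    using assms by (auto simp: indep_var_distribution_eq)
  interpret X: prob_space "distr M borel X" by (rule prob_space_distr) simp
  interpret Y: prob_space "distr M borel Y" by (rule prob_space_distr) simp
  interpret XY: pair_prob_space "distr M borel X" "distr M borel Y" ..
  let ?f = "\<lambda>x y. iexp (t * (x * y))"
  have int: "integrable (distr M borel X \<Otimes>\<^sub>M distr M borel Y) (case_prod ?f)"
    by (rule XY.integrable_const_bound[where B = 1]) (auto simp: split_beta)
  have "char (distr M borel (\<lambda>\<omega>. X \<omega> * Y \<omega>)) t = (LINT \<omega>|M. ?f (X \<omega>) (Y \<omega>))"
    unfolding char_def by (subst integral_distr) auto
  also have "\<dots> = integral\<^sup>L (distr M borel X \<Otimes>\<^sub>M distr M borel Y) (case_prod ?f)"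
    unfolding joint by (subst integral_distr) (auto simp: split_beta)
  also have "\<dots> = (LINT y|distr M borel Y. LINT x|distr M borel X. ?f x y)"
    by (rule XY.integral_snd[OF int, symmetric])
  also have "\<dots> = (LINT y|distr M borel Y. char (distr M borel X) (t * y))"
    unfolding char_def by (simp add: mult_ac)
  also have "\<dots> = (LINT \<omega>|M. char (distr M borel X) (t * Y \<omega>))"
  proof (rule integral_distr)
    interpret X': real_distribution "distr M borel X"
      by (rule real_distribution_distr) simp
    have [measurable]: "char (distr M borel X) \<in> borel_measurable borel"
      by (rule X'.char_measurable)
    show "(\<lambda>y. char (distr M borel X) (t * y)) \<in> borel_measurable borel" by measurable
  qed simp
  finally show ?thesis .
qed

lemma stable_exponent_scale:
  fixes a m t :: real
  assumes "a \<noteq> 0" and "0 \<le> m"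
  shows "\<bar>t * m powr (1 / a)\<bar> powr a = \<bar>t\<bar> powr a * m"
  using assms by (simp add: abs_mult powr_mult powr_powr)

theorem theorem1:
  fixes \<alpha> \<alpha>' :: real
    and P :: "'a measure" and Q :: "'b measure"
    and S M :: "'a \<Rightarrow> real" and L :: "'b \<Rightarrow> real"
  assumes "\<alpha> \<in> {0<..2}" and "\<alpha>' \<in> {0<..1}"
    and "prob_space P" and "prob_space Q"
    and "linnik_rv Q (\<alpha> * \<alpha>') L"
    and "symmetric_stable_rv P \<alpha> S"
    and "mittag_leffler_rv P \<alpha>' M"
    and "prob_space.indep_var P borel S borel M"
  shows "distr Q borel L = distr P borel (\<lambda>\<omega>. S \<omega> * M \<omega> powr (1 / \<alpha>))"
proof -
  interpret P: prob_space P by fact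
  interpret Q: prob_space Q by fact
  let ?Y = "\<lambda>\<omega>. M \<omega> powr (1 / \<alpha>)"
  have [measurable]: "L \<in> borel_measurable Q" "S \<in> borel_measurable P" "M \<in> borel_measurable P"
    and char_L: "\<And>t. char (distr Q borel L) t = of_real (1 / (1 + \<bar>t\<bar> powr (\<alpha> * \<alpha>')))"
    and char_S: "\<And>t. char (distr P borel S) t = of_real (exp (- (\<bar>t\<bar> powr \<alpha>)))"
    and M_nonneg: "AE \<omega> in P. 0 \<le> M \<omega>"
    and laplace_M: "\<And>s. 0 \<le> s \<Longrightarrow> (LINT \<omega>|P. exp (- (s * M \<omega>))) = 1 / (1 + s powr \<alpha>')"
    using assms by (auto simp: linnik_rv_def symmetric_stable_rv_def mittag_leffler_rv_def)
  have "P.indep_var borel (id \<circ> S) borel ((\<lambda>m. m powr (1 / \<alpha>)) \<circ> M)"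
    by (rule P.indep_var_compose[OF assms(8)]) auto
  then have indep: "P.indep_var borel S borel ?Y"
    by (simp add: comp_def)
  have "char (distr Q borel L) t = char (distr P borel (\<lambda>\<omega>. S \<omega> * ?Y \<omega>)) t" for t
  proof -
    have "char (distr P borel (\<lambda>\<omega>. S \<omega> * ?Y \<omega>)) t
        = (LINT \<omega>|P. complex_of_real (exp (- (\<bar>t * ?Y \<omega>\<bar> powr \<alpha>))))"
      by (simp add: P.char_indep_mult[OF indep] char_S)
    also have "\<dots> = of_real (LINT \<omega>|P. exp (- (\<bar>t * ?Y \<omega>\<bar> powr \<alpha>)))"
      by (rule integral_complex_of_real)
    also have "(LINT \<omega>|P. exp (- (\<bar>t * ?Y \<omega>\<bar> powr \<alpha>)))
        = (LINT \<omega>|P. exp (- (\<bar>t\<bar> powr \<alpha> * M \<omega>)))"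
    proof (rule integral_cong_AE)
      show "AE \<omega> in P. exp (- (\<bar>t * ?Y \<omega>\<bar> powr \<alpha>)) = exp (- (\<bar>t\<bar> powr \<alpha> * M \<omega>))"
        using M_nonneg by eventually_elim (use assms(1) in \<open>simp add: stable_exponent_scale\<close>)
    qed measurable
    also have "\<dots> = 1 / (1 + \<bar>t\<bar> powr (\<alpha> * \<alpha>'))"
      by (simp add: laplace_M powr_powr)
    finally show ?thesis by (simp add: char_L)
  qed
  then have char_eq:
    "char (distr Q borel L) = char (distr P borel (\<lambda>\<omega>. S \<omega> * ?Y \<omega>))" ..
  show ?thesis
    by (rule Levy_uniqueness[OF _ _ char_eq])
      (auto intro!: Q.real_distribution_distr P.real_distribution_distr)
qed

end
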